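(* Let $R$ be a Dedekind domain, let $P$ be a nonzero prime ideal of $R$ such that $R/P$ is finite, and let $r$ and $\alpha$ be positive integers. Then \[\mathscr{S}_r(R/P^{\alpha})=\begin{cases} |R/P|^{\alpha-1}(|R/P|-r), & \text{if } r\leq \operatorname{char}(R/P);\\ |R/P|^{\alpha-1}(|R/P|-\operatorname{char}(R/P)), & \text{if } r>\operatorname{char}(R/P).\end{cases}\]
   Context: For an ideal $I$ of a Dedekind domain $R$ with $R/I$ finite and a positive integer $r$, define $L_r(R/I)=\{a+I\in R/I : a+i+I\in U(R/I)\text{ for all } i\in\{0,1,\ldots,r-1\}\}$, where $U(\cdot)$ denotes the group of units and an integer $i$ is viewed as the element $1+1+\cdots+1$ ($i$ times) of $R$. Set $\mathscr{S}_r(R/I)=|L_r(R/I)|$. $\operatorname{char}(X)$ denotes the characteristic of a ring $X$. *)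

theory Defs
  imports "HOL-Algebra.Algebra"
begin

section \<open>The field of fractions\<close>

text \<open>The fraction \<open>a/b\<close> is the equivalence class of the pair \<open>(a, b)\<close>.  The operations
  are defined on classes as in a quotient: the unions below range over equal sets.\<close>

definition fraction :: "('a, 'b) ring_scheme \<Rightarrow> 'a \<Rightarrow> 'a \<Rightarrow> ('a \<times> 'a) set"
  where "fraction R a b =
    {(c, d). c \<in> carrier R \<and> d \<in> carrier R - {\<zero>\<^bsub>R\<^esub>} \<and> a \<otimes>\<^bsub>R\<^esub> d = c \<otimes>\<^bsub>R\<^esub> b}"

definition frac_field :: "('a, 'b) ring_scheme \<Rightarrow> ('a \<times> 'a) set ring"
  where "frac_field R =
    \<lparr> carrier = {fraction R a b | a b. a \<in> carrier R \<and> b \<in> carrier R - {\<zero>\<^bsub>R\<^esub>}},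
      monoid.mult = (\<lambda>x y. \<Union>(a, b)\<in>x. \<Union>(c, d)\<in>y. fraction R (a \<otimes>\<^bsub>R\<^esub> c) (b \<otimes>\<^bsub>R\<^esub> d)),
      monoid.one = fraction R \<one>\<^bsub>R\<^esub> \<one>\<^bsub>R\<^esub>,
      ring.zero = fraction R \<zero>\<^bsub>R\<^esub> \<one>\<^bsub>R\<^esub>,
      ring.add = (\<lambda>x y. \<Union>(a, b)\<in>x. \<Union>(c, d)\<in>y.
        fraction R ((a \<otimes>\<^bsub>R\<^esub> d) \<oplus>\<^bsub>R\<^esub> (c \<otimes>\<^bsub>R\<^esub> b)) (b \<otimes>\<^bsub>R\<^esub> d)) \<rparr>"

definition base_ring :: "('a, 'b) ring_scheme \<Rightarrow> ('a \<times> 'a) set set"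
  where "base_ring R = (\<lambda>a. fraction R a \<one>\<^bsub>R\<^esub>) ` carrier R"

context domain
begin

lemma frac_trans:
  assumes "a \<in> carrier R" "b \<in> carrier R" "c \<in> carrier R" "d \<in> carrier R" "e \<in> carrier R"
    "f \<in> carrier R" "d \<noteq> \<zero>" "a \<otimes> d = c \<otimes> b" "c \<otimes> f = e \<otimes> d"
  shows "a \<otimes> f = e \<otimes> b"
proof -
  have "d \<otimes> (a \<otimes> f) = (a \<otimes> d) \<otimes> f" using assms(1-7) by (simp add: m_ac)
  also have "\<dots> = (c \<otimes> f) \<otimes> b" unfolding assms(8) using assms(1-7) by (simp add: m_ac)
  also have "\<dots> = d \<otimes> (e \<otimes> b)" unfolding assms(9) using assms(1-7) by (simp add: m_ac)
  finally show ?thesis using assms m_lcancel by simp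
qed

lemma frac_eq_iff:
  assumes "a \<in> carrier R" "b \<in> carrier R - {\<zero>}" "c \<in> carrier R" "d \<in> carrier R - {\<zero>}"
  shows "fraction R a b = fraction R c d \<longleftrightarrow> a \<otimes> d = c \<otimes> b"
proof
  assume "fraction R a b = fraction R c d"
  moreover have "(c, d) \<in> fraction R c d" using assms by (simp add: fraction_def)
  ultimately have "(c, d) \<in> fraction R a b" by simp
  then show "a \<otimes> d = c \<otimes> b" by (simp add: fraction_def)
next
  assume eq: "a \<otimes> d = c \<otimes> b"
  have "x \<in> fraction R a b \<longleftrightarrow> x \<in> fraction R c d" for x
  proof (cases x)
    case (Pair e f)
    have "c \<otimes> f = e \<otimes> d" if "e \<in> carrier R" "f \<in> carrier R" "a \<otimes> f = e \<otimes> b"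
      using frac_trans[of c d a b e f] assms that eq by simp
    moreover have "a \<otimes> f = e \<otimes> b" if "e \<in> carrier R" "f \<in> carrier R" "c \<otimes> f = e \<otimes> d"
      using frac_trans[of a b c d e f] assms that eq by simp
    ultimately show ?thesis
      unfolding Pair fraction_def by blast
  qed
  then show "fraction R a b = fraction R c d" by blast
qed

lemma frac_self:
  assumes "a \<in> carrier R" "b \<in> carrier R - {\<zero>}"
  shows "(a, b) \<in> fraction R a b"
  using assms by (simp add: fraction_def)

lemma UN_frac:
  assumes "a \<in> carrier R" "b \<in> carrier R - {\<zero>}" "c \<in> carrier R" "d \<in> carrier R - {\<zero>}"
    and "\<And>a' b' c' d'. (a', b') \<in> fraction R a b \<Longrightarrow> (c', d') \<in> fraction R c d \<Longrightarrow> F a' b' c' d' = Z"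
  shows "(\<Union>(a', b')\<in>fraction R a b. \<Union>(c', d')\<in>fraction R c d. F a' b' c' d') = Z"
  using assms(5) frac_self[OF assms(1,2)] frac_self[OF assms(3,4)] by fast

lemma frac_mult:
  assumes "a \<in> carrier R" "b \<in> carrier R - {\<zero>}" "c \<in> carrier R" "d \<in> carrier R - {\<zero>}"
  shows "fraction R a b \<otimes>\<^bsub>frac_field R\<^esub> fraction R c d = fraction R (a \<otimes> c) (b \<otimes> d)"
  unfolding frac_field_def monoid.simps
proof (rule UN_frac[OF assms])
  fix a' b' c' d' assume "(a', b') \<in> fraction R a b" "(c', d') \<in> fraction R c d"
  then have c: "a' \<in> carrier R" "b' \<in> carrier R - {\<zero>}" "c' \<in> carrier R" "d' \<in> carrier R - {\<zero>}"
    and e: "a \<otimes> b' = a' \<otimes> b" "c \<otimes> d' = c' \<otimes> d" by (auto simp: fraction_def)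
  have "(a' \<otimes> c') \<otimes> (b \<otimes> d) = (a' \<otimes> b) \<otimes> (c' \<otimes> d)" using assms c by (simp add: m_ac)
  also have "\<dots> = (a \<otimes> c) \<otimes> (b' \<otimes> d')" unfolding e[symmetric] using assms c by (simp add: m_ac)
  finally show "fraction R (a' \<otimes> c') (b' \<otimes> d') = fraction R (a \<otimes> c) (b \<otimes> d)"
    using assms c by (subst frac_eq_iff) (auto simp: integral_iff)
qed

lemma frac_add:
  assumes "a \<in> carrier R" "b \<in> carrier R - {\<zero>}" "c \<in> carrier R" "d \<in> carrier R - {\<zero>}"
  shows "fraction R a b \<oplus>\<^bsub>frac_field R\<^esub> fraction R c d = fraction R (a \<otimes> d \<oplus> c \<otimes> b) (b \<otimes> d)"
  unfolding frac_field_def ring.simps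
proof (rule UN_frac[OF assms])
  fix a' b' c' d' assume "(a', b') \<in> fraction R a b" "(c', d') \<in> fraction R c d"
  then have c: "a' \<in> carrier R" "b' \<in> carrier R - {\<zero>}" "c' \<in> carrier R" "d' \<in> carrier R - {\<zero>}"
    and e: "a \<otimes> b' = a' \<otimes> b" "c \<otimes> d' = c' \<otimes> d" by (auto simp: fraction_def)
  have "(a' \<otimes> d' \<oplus> c' \<otimes> b') \<otimes> (b \<otimes> d)
      = (a' \<otimes> b) \<otimes> (d' \<otimes> d) \<oplus> (c' \<otimes> d) \<otimes> (b' \<otimes> b)"
    using assms c by (simp add: m_ac l_distr r_distr)
  also have "\<dots> = (a \<otimes> d \<oplus> c \<otimes> b) \<otimes> (b' \<otimes> d')"
    unfolding e[symmetric] using assms c by (simp add: m_ac l_distr r_distr)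
  finally show "fraction R (a' \<otimes> d' \<oplus> c' \<otimes> b') (b' \<otimes> d') = fraction R (a \<otimes> d \<oplus> c \<otimes> b) (b \<otimes> d)"
    using assms c by (subst frac_eq_iff) (auto simp: integral_iff)
qed

lemma frac_closed:
  assumes "a \<in> carrier R" "b \<in> carrier R - {\<zero>}"
  shows "fraction R a b \<in> carrier (frac_field R)"
  using assms by (auto simp: frac_field_def)

lemma frac_cases:
  assumes "x \<in> carrier (frac_field R)"
  obtains a b where "a \<in> carrier R" "b \<in> carrier R - {\<zero>}" "x = fraction R a b"
  using assms by (auto simp: frac_field_def)

lemma frac_one: "\<one>\<^bsub>frac_field R\<^esub> = fraction R \<one> \<one>"
  and frac_zero: "\<zero>\<^bsub>frac_field R\<^esub> = fraction R \<zero> \<one>"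
  by (simp_all add: frac_field_def)

lemmas frac_simps = frac_add frac_mult frac_one frac_zero frac_closed frac_eq_iff integral_iff

lemma field_frac_field: "field (frac_field R)"
proof (rule cring.cring_fieldI2)
  show "cring (frac_field R)"
  proof (rule cringI)
    show "abelian_group (frac_field R)"
    proof (rule abelian_groupI)
      fix x assume "x \<in> carrier (frac_field R)"
      then obtain a b where x: "a \<in> carrier R" "b \<in> carrier R - {\<zero>}" "x = fraction R a b"
        by (rule frac_cases)
      then show "\<zero>\<^bsub>frac_field R\<^esub> \<oplus>\<^bsub>frac_field R\<^esub> x = x"
        by (simp add: frac_simps)
      have "fraction R (\<ominus> a) b \<oplus>\<^bsub>frac_field R\<^esub> x = \<zero>\<^bsub>frac_field R\<^esub>"
        using x by (simp add: frac_simps l_minus l_neg)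
      then show "\<exists>y\<in>carrier (frac_field R). y \<oplus>\<^bsub>frac_field R\<^esub> x = \<zero>\<^bsub>frac_field R\<^esub>"
        using x frac_closed[of "\<ominus> a" b] by blast
    next
      fix x y z
      assume "x \<in> carrier (frac_field R)" "y \<in> carrier (frac_field R)" "z \<in> carrier (frac_field R)"
      then obtain a b c d e f where "a \<in> carrier R" "b \<in> carrier R - {\<zero>}" "x = fraction R a b"
        "c \<in> carrier R" "d \<in> carrier R - {\<zero>}" "y = fraction R c d"
        "e \<in> carrier R" "f \<in> carrier R - {\<zero>}" "z = fraction R e f"
        by (metis frac_cases)
      then show "x \<oplus>\<^bsub>frac_field R\<^esub> y \<oplus>\<^bsub>frac_field R\<^esub> z
          = x \<oplus>\<^bsub>frac_field R\<^esub> (y \<oplus>\<^bsub>frac_field R\<^esub> z)"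
        by (simp add: frac_simps m_ac l_distr r_distr a_ac)
    next
      fix x y
      assume "x \<in> carrier (frac_field R)" "y \<in> carrier (frac_field R)"
      then obtain a b c d where "a \<in> carrier R" "b \<in> carrier R - {\<zero>}" "x = fraction R a b"
        "c \<in> carrier R" "d \<in> carrier R - {\<zero>}" "y = fraction R c d"
        by (metis frac_cases)
      then show "x \<oplus>\<^bsub>frac_field R\<^esub> y \<in> carrier (frac_field R)"
        "x \<oplus>\<^bsub>frac_field R\<^esub> y = y \<oplus>\<^bsub>frac_field R\<^esub> x"
        by (simp_all add: frac_simps m_ac a_ac)
    qed (simp add: frac_simps)
  next
    show "comm_monoid (frac_field R)"
    proof (rule comm_monoidI)
      fix x y z
      assume "x \<in> carrier (frac_field R)" "y \<in> carrier (frac_field R)" "z \<in> carrier (frac_field R)"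
      then obtain a b c d e f where "a \<in> carrier R" "b \<in> carrier R - {\<zero>}" "x = fraction R a b"
        "c \<in> carrier R" "d \<in> carrier R - {\<zero>}" "y = fraction R c d"
        "e \<in> carrier R" "f \<in> carrier R - {\<zero>}" "z = fraction R e f"
        by (metis frac_cases)
      then show "x \<otimes>\<^bsub>frac_field R\<^esub> y \<otimes>\<^bsub>frac_field R\<^esub> z
          = x \<otimes>\<^bsub>frac_field R\<^esub> (y \<otimes>\<^bsub>frac_field R\<^esub> z)"
        by (simp add: frac_simps m_ac)
    next
      fix x y
      assume "x \<in> carrier (frac_field R)" "y \<in> carrier (frac_field R)"
      then obtain a b c d where "a \<in> carrier R" "b \<in> carrier R - {\<zero>}" "x = fraction R a b"
        "c \<in> carrier R" "d \<in> carrier R - {\<zero>}" "y = fraction R c d"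
        by (metis frac_cases)
      then show "x \<otimes>\<^bsub>frac_field R\<^esub> y \<in> carrier (frac_field R)"
        "x \<otimes>\<^bsub>frac_field R\<^esub> y = y \<otimes>\<^bsub>frac_field R\<^esub> x"
        by (simp_all add: frac_simps m_ac)
    next
      fix x assume "x \<in> carrier (frac_field R)"
      then obtain a b where "a \<in> carrier R" "b \<in> carrier R - {\<zero>}" "x = fraction R a b"
        by (rule frac_cases)
      then show "\<one>\<^bsub>frac_field R\<^esub> \<otimes>\<^bsub>frac_field R\<^esub> x = x"
        by (simp add: frac_simps)
    qed (simp add: frac_simps)
  next
    fix x y z
    assume "x \<in> carrier (frac_field R)" "y \<in> carrier (frac_field R)" "z \<in> carrier (frac_field R)"
    then obtain a b c d e f where "a \<in> carrier R" "b \<in> carrier R - {\<zero>}" "x = fraction R a b"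
      "c \<in> carrier R" "d \<in> carrier R - {\<zero>}" "y = fraction R c d"
      "e \<in> carrier R" "f \<in> carrier R - {\<zero>}" "z = fraction R e f"
      by (metis frac_cases)
    then show "(x \<oplus>\<^bsub>frac_field R\<^esub> y) \<otimes>\<^bsub>frac_field R\<^esub> z
        = x \<otimes>\<^bsub>frac_field R\<^esub> z \<oplus>\<^bsub>frac_field R\<^esub> y \<otimes>\<^bsub>frac_field R\<^esub> z"
      by (simp add: frac_simps m_ac l_distr r_distr)
  qed
next
  show "\<zero>\<^bsub>frac_field R\<^esub> \<noteq> \<one>\<^bsub>frac_field R\<^esub>"
    by (simp add: frac_simps)
next
  fix x assume "x \<in> carrier (frac_field R)" and nz: "x \<noteq> \<zero>\<^bsub>frac_field R\<^esub>"
  then obtain a b where x: "a \<in> carrier R" "b \<in> carrier R - {\<zero>}" "x = fraction R a b"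
    by (metis frac_cases)
  with nz have "a \<noteq> \<zero>" by (auto simp: frac_simps)
  with x have "x \<otimes>\<^bsub>frac_field R\<^esub> fraction R b a = \<one>\<^bsub>frac_field R\<^esub>"
    by (simp add: frac_simps m_comm)
  then show "\<exists>y\<in>carrier (frac_field R). x \<otimes>\<^bsub>frac_field R\<^esub> y = \<one>\<^bsub>frac_field R\<^esub>"
    using x \<open>a \<noteq> \<zero>\<close> frac_closed[of b a] by blast
qed

lemma base_ring_hom: "(\<lambda>a. fraction R a \<one>) \<in> ring_hom R (frac_field R)"
  by (rule ring_hom_memI) (simp_all add: frac_simps)

lemma base_ring_inj: "inj_on (\<lambda>a. fraction R a \<one>) (carrier R)"
  by (rule inj_onI) (simp add: frac_simps)

end


section \<open>Dedekind domains\<close>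

text \<open>\<open>p \<noteq> []\<close> excludes the zero polynomial, whose \<open>lead_coeff\<close> is unspecified.\<close>

definition integral_over :: "('c, 'd) ring_scheme \<Rightarrow> 'c set \<Rightarrow> 'c \<Rightarrow> bool"
  where "integral_over K S x \<longleftrightarrow>
    (\<exists>p \<in> carrier (univ_poly K S). p \<noteq> [] \<and> lead_coeff p = \<one>\<^bsub>K\<^esub> \<and> ring.eval K p x = \<zero>\<^bsub>K\<^esub>)"

definition integrally_closed :: "('a, 'b) ring_scheme \<Rightarrow> bool"
  where "integrally_closed R \<longleftrightarrow>
    (\<forall>x \<in> carrier (frac_field R).
      integral_over (frac_field R) (base_ring R) x \<longrightarrow> x \<in> base_ring R)"

text \<open>Fields are admitted.\<close>

locale dedekind_domain = noetherian_domain +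
  assumes integrally_closed: "integrally_closed R"
    and primeideal_maximal: "\<lbrakk> primeideal P R; P \<noteq> {\<zero>} \<rbrakk> \<Longrightarrow> maximalideal P R"


section \<open>Characteristic and the function \<open>\<S>\<^sub>r\<close>\<close>

definition ring_char :: "('a, 'b) ring_scheme \<Rightarrow> nat"
  where "ring_char R =
    (if \<exists>n::nat>0. add_pow R n \<one>\<^bsub>R\<^esub> = \<zero>\<^bsub>R\<^esub>
     then LEAST n::nat. 0 < n \<and> add_pow R n \<one>\<^bsub>R\<^esub> = \<zero>\<^bsub>R\<^esub>
     else 0)"

text \<open>\<open>L_set R I r\<close> is \<open>L\<^sub>r(R/I)\<close> and \<open>S_fun R I r\<close> is \<open>\<S>\<^sub>r(R/I)\<close>.\<close>

definition L_set :: "('a, 'b) ring_scheme \<Rightarrow> 'a set \<Rightarrow> nat \<Rightarrow> 'a set set"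
  where "L_set R I r =
    {I +>\<^bsub>R\<^esub> a | a. a \<in> carrier R \<and>
      (\<forall>i \<in> {0..<r}. I +>\<^bsub>R\<^esub> (a \<oplus>\<^bsub>R\<^esub> add_pow R i \<one>\<^bsub>R\<^esub>) \<in> Units (R Quot I))}"

definition S_fun :: "('a, 'b) ring_scheme \<Rightarrow> 'a set \<Rightarrow> nat \<Rightarrow> nat"
  where "S_fun R I r = card (L_set R I r)"

end

(*
  Since P is a maximal element of a family of colon ideals, P = (a : b) for some a, b with b not
  in (a). If b P were contained in a P, the fraction b/a would be integral over R, hence in R. So
  b q = a u for some q in P and u outside P. It follows that u P is contained in (q), and that the
  power q^k generates P^k / P^(k+1), a copy of R/P. Being a unit modulo P^k depends only on
  the residue modulo P, so the count for P^k is |R/P|^(k-1) times the count for P, where the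
  residues of 0, -1, ..., -(r-1) have to be removed.
*)
theory Submission
  imports Defs
begin

text \<open>The count needs P^k / P^(k+1) to be neither larger nor smaller than R/P. The relation b
  q = a u gives both bounds by computing with elements of R, without localization, inverse ideals or
  factorization of ideals: b/a acts like the inverse of a uniformizer at P. Since u P lies in (q)
  and u is invertible modulo P, the power q^k generates; since b P lies in (a), b^k P^(k+1) lies in
  a^k P, which keeps y q^k out of P^(k+1) for y outside P. The two cases of the formula are one:
  integers repeat in R/P with period char(R/P), so min(r, char(R/P)) residues are removed.\<close>

section \<open>Maximal members of families of ideals; colon ideals\<close>

text \<open>In a noetherian ring the union of a nonempty chain of ideals is itself a member of the
  chain, so Zorn's lemma applies to any family of ideals, whether or not it is closed under
  unions.\<close>

lemma (in noetherian_ring) ex_maximal_ideal_in_family: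
  assumes "S \<noteq> {}" "S \<subseteq> {I. ideal I R}"
  shows "\<exists>M\<in>S. \<forall>I\<in>S. M \<subseteq> I \<longrightarrow> I = M"
proof (rule subset_Zorn_nonempty[OF assms(1)])
  fix C assume C: "C \<noteq> {}" "subset.chain S C"
  then have "C \<subseteq> S" by (simp add: pred_on.chain_def)
  then have "subset.chain {I. ideal I R} C"
    using assms(2) C(2) unfolding pred_on.chain_def by (meson order_trans)
  from ideal_chain_is_trivial[OF C(1) this] show "\<Union>C \<in> S"
    using \<open>C \<subseteq> S\<close> by (rule subsetD[rotated])
qed

lemma (in cring) colon_ideal:
  assumes "ideal I R" "b \<in> carrier R"
  shows "ideal {y \<in> carrier R. y \<otimes> b \<in> I} R"
proof -
  interpret I: ideal I R by fact
  show ?thesis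
  proof (rule idealI[OF ring_axioms])
    show "subgroup {y \<in> carrier R. y \<otimes> b \<in> I} (add_monoid R)"
      by (rule add.subgroupI) (use assms(2) in \<open>auto simp: l_distr l_minus intro!: exI[of _ \<zero>]\<close>)
    fix y x assume y: "y \<in> {y \<in> carrier R. y \<otimes> b \<in> I}" and x: "x \<in> carrier R"
    then have "x \<otimes> (y \<otimes> b) \<in> I" by (simp add: I.I_l_closed)
    then show "x \<otimes> y \<in> {y \<in> carrier R. y \<otimes> b \<in> I}" "y \<otimes> x \<in> {y \<in> carrier R. y \<otimes> b \<in> I}"
      using y x assms(2) by (simp_all add: m_ac)
  qed
qed

section \<open>A local uniformizer at a prime\<close>

context dedekind_domain
begin

text \<open>This replaces the usual argument with products of primes: a colon ideal \<open>(a : b)\<close> that is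
  maximal among those contained in \<open>P\<close> is prime, hence equal to \<open>P\<close>.\<close>

lemma prime_eq_colon:
  assumes P: "primeideal P R" and a: "a \<in> P" "a \<noteq> \<zero>"
  obtains b where "b \<in> carrier R" "P = {y \<in> carrier R. y \<otimes> b \<in> PIdl a}"
proof -
  interpret P: primeideal P R by fact
  have ac: "a \<in> carrier R" using a P.Icarr by blast
  interpret I: ideal "PIdl a" R by (rule cgenideal_ideal[OF ac])
  define Q where "Q b = {y \<in> carrier R. y \<otimes> b \<in> PIdl a}" for b
  have Q_ideal: "ideal (Q b) R" if "b \<in> carrier R" for b
    unfolding Q_def using colon_ideal[OF I.ideal_axioms that] .
  define S where "S = {Q b | b. b \<in> carrier R \<and> Q b \<subseteq> P}"
  have "Q \<one> \<subseteq> P"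
    using cgenideal_minimal[OF P.ideal_axioms a(1)] by (auto simp: Q_def)
  then have "S \<noteq> {}" unfolding S_def using one_closed by blast
  moreover have "S \<subseteq> {I. ideal I R}" unfolding S_def using Q_ideal by blast
  ultimately obtain M where M: "M \<in> S" "\<forall>I\<in>S. M \<subseteq> I \<longrightarrow> I = M"
    using ex_maximal_ideal_in_family by meson
  then obtain b where b: "b \<in> carrier R" "Q b \<subseteq> P" "M = Q b" unfolding S_def by blast
  have max: "Q c = Q b" if "c \<in> carrier R" "Q c \<subseteq> P" "Q b \<subseteq> Q c" for c
    using M(2) b(3) that unfolding S_def by blast
  have "primeideal (Q b) R"
  proof (rule primeidealI[OF Q_ideal[OF b(1)] is_cring])
    show "carrier R \<noteq> Q b" using b(2) P.I_notcarr P.a_subset by blast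
    fix s t assume st: "s \<in> carrier R" "t \<in> carrier R" "s \<otimes> t \<in> Q b"
    show "s \<in> Q b \<or> t \<in> Q b"
    proof (rule disjCI)
      assume "t \<notin> Q b"
      have stb: "s \<otimes> b \<in> carrier R" using st b by simp
      have "Q b \<subseteq> Q (s \<otimes> b)"
      proof
        fix y assume y: "y \<in> Q b"
        then have "s \<otimes> (y \<otimes> b) \<in> PIdl a" using I.I_l_closed st(1) by (simp add: Q_def)
        moreover have "s \<otimes> (y \<otimes> b) = y \<otimes> (s \<otimes> b)" using y st(1) b(1) by (simp add: Q_def m_ac)
        ultimately show "y \<in> Q (s \<otimes> b)" using y by (simp add: Q_def)
      qed
      moreover have "s \<otimes> t \<otimes> b = t \<otimes> (s \<otimes> b)" using st b(1) by (simp add: m_ac)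
      then have "t \<in> Q (s \<otimes> b)" using st by (simp add: Q_def)
      \<comment> \<open>Otherwise maximality would give \<open>Q (s \<otimes> b) = Q b\<close>,
        although \<open>t\<close> lies only in the former.\<close>
      ultimately have "\<not> Q (s \<otimes> b) \<subseteq> P"
        using max[OF stb] \<open>t \<notin> Q b\<close> by blast
      then obtain w where w: "w \<in> carrier R" "w \<otimes> (s \<otimes> b) \<in> PIdl a" "w \<notin> P"
        by (auto simp: Q_def)
      \<comment> \<open>As \<open>w\<close> is outside the prime P, passing from \<open>b\<close> to
        \<open>b \<otimes> w\<close> keeps the colon ideal inside P. Maximality then makes it equal
        to \<open>Q b\<close>, and \<open>s\<close> belongs to it by the choice of
        \<open>w\<close>.\<close>
      have "Q (b \<otimes> w) \<subseteq> P"
      proof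
        fix y assume y: "y \<in> Q (b \<otimes> w)"
        then have "y \<otimes> w \<otimes> b = y \<otimes> (b \<otimes> w)" using w(1) b(1) by (simp add: Q_def m_ac)
        then have "y \<otimes> w \<in> Q b" using w(1) y by (simp add: Q_def)
        then show "y \<in> P" using P.I_prime[of y w] y w b(2) by (auto simp: Q_def)
      qed
      moreover have "Q b \<subseteq> Q (b \<otimes> w)"
        using I.I_r_closed w(1) b(1) by (auto simp: Q_def m_assoc[symmetric])
      ultimately have "Q (b \<otimes> w) = Q b" using max[of "b \<otimes> w"] b w by simp
      moreover have "w \<otimes> (s \<otimes> b) = s \<otimes> (b \<otimes> w)" using st(1) w(1) b(1) by (simp add: m_ac)
      then have "s \<in> Q (b \<otimes> w)" using st w by (simp add: Q_def)
      ultimately show "s \<in> Q b" by simp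
    qed
  qed
  \<comment> \<open>The nonzero \<open>a\<close> makes \<open>Q b\<close> a nonzero prime, hence
    maximal, and P is a proper ideal containing it.\<close>
  moreover have "a \<in> Q b" using ac b cgenideal_self[OF ac] I.I_r_closed by (simp add: Q_def)
  then have "Q b \<noteq> {\<zero>}" using a(2) by blast
  ultimately interpret M: maximalideal "Q b" R by (rule primeideal_maximal)
  have "P = Q b"
    using M.I_maximal[OF P.ideal_axioms b(2) P.a_subset] P.I_notcarr by blast
  then show thesis using that[OF b(1)] by (simp only: Q_def)
qed

text \<open>The hypothesis says that x = b/a maps P into itself. In place of a determinant, the
  elements x^n a of P are followed: the ideals they generate form an ascending chain, so some x^n a
  is a combination of the earlier ones, and cancelling \<open>a\<close> leaves a monic equation for
  x over R.\<close>

lemma cgenidealI_integral: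
  assumes P: "ideal P R" and a: "a \<in> P" "a \<noteq> \<zero>" and b: "b \<in> carrier R"
    and closed: "\<And>p. p \<in> P \<Longrightarrow> \<exists>p'\<in>P. b \<otimes> p = a \<otimes> p'"
  shows "b \<in> PIdl a"
proof -
  interpret P: ideal P R by fact
  define K where "K = frac_field R"
  define f where "f r = fraction R r \<one>" for r
  define x where "x = fraction R b a"
  have ac: "a \<in> carrier R" using a P.Icarr by blast
  interpret K: field K unfolding K_def by (rule field_frac_field)
  have f_closed[simp]: "f r \<in> carrier K" if "r \<in> carrier R" for r
    using that by (simp add: f_def K_def frac_closed)
  have f_mult: "f (r \<otimes> s) = f r \<otimes>\<^bsub>K\<^esub> f s" and f_add: "f (r \<oplus> s) = f r \<oplus>\<^bsub>K\<^esub> f s"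
    if "r \<in> carrier R" "s \<in> carrier R" for r s
    using that by (simp_all add: f_def K_def frac_simps)
  have f_one: "f \<one> = \<one>\<^bsub>K\<^esub>" and f_zero: "f \<zero> = \<zero>\<^bsub>K\<^esub>"
    by (simp_all add: f_def K_def frac_simps)
  have f_eq: "f r = f s \<longleftrightarrow> r = s" if "r \<in> carrier R" "s \<in> carrier R" for r s
    using that by (simp add: f_def frac_simps)
  have base: "base_ring R = f ` carrier R" by (simp add: base_ring_def f_def)
  have x: "x \<in> carrier K" using ac a b by (simp add: x_def K_def frac_closed)
  obtain g where g: "\<And>p. p \<in> P \<Longrightarrow> g p \<in> P" "\<And>p. p \<in> P \<Longrightarrow> b \<otimes> p = a \<otimes> g p"
    using closed by metis
  \<comment> \<open>\<open>c n\<close> is x^n a, computed inside P by \<open>g\<close>, which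
    realizes multiplication by x on P.\<close>
  define c where "c n = (g ^^ n) a" for n
  have cP: "c n \<in> P" for n by (induction n) (simp_all add: c_def a g)
  then have cc[simp]: "c n \<in> carrier R" for n using P.Icarr by blast
  have fc: "f (c n) = x [^]\<^bsub>K\<^esub> n \<otimes>\<^bsub>K\<^esub> f a" for n
  proof (induction n)
    case 0
    show ?case using ac by (simp add: c_def)
  next
    case (Suc n)
    have "b \<otimes> c n = a \<otimes> c (Suc n)" using g(2)[OF cP] by (simp add: c_def)
    then have "f (c (Suc n)) = x \<otimes>\<^bsub>K\<^esub> f (c n)"
      using cc[of n] cc[of "Suc n"] ac a b
      by (simp add: x_def f_def K_def frac_simps m_comm)
    then show ?case using Suc x ac by (simp add: K.m_ac)
  qed
  \<comment> \<open>\<open>J n\<close> is the ideal generated by \<open>c 0\<close>, ...,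
    \<open>c (n - 1)\<close>.\<close>
  define J where "J = rec_nat {\<zero>} (\<lambda>n I. PIdl (c n) <+> I)"
  have J: "J 0 = {\<zero>}" "\<And>n. J (Suc n) = PIdl (c n) <+> J n" by (simp_all add: J_def)
  have J_ideal: "ideal (J n) R" for n
    by (induction n) (simp_all add: J zeroideal add_ideals cgenideal_ideal)
  have J_mono: "J n \<subseteq> J (Suc n)" for n
  proof
    fix y assume y: "y \<in> J n"
    have "y \<in> carrier R" using ideal.Icarr[OF J_ideal y] .
    moreover have "\<zero> \<in> PIdl (c n)"
      using additive_subgroup.zero_closed[OF ideal.axioms(1)[OF cgenideal_ideal[OF cc]]] .
    ultimately have "\<zero> \<oplus> y \<in> J (Suc n)"
      unfolding J(2) set_add_def' using y by blast
    then show "y \<in> J (Suc n)" using \<open>y \<in> carrier R\<close> by simp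
  qed
  have "\<exists>n. J (Suc n) = J n"
  proof -
    have "range J \<noteq> {}" "range J \<subseteq> {I. ideal I R}" using J_ideal by auto
    then obtain M where M: "M \<in> range J" "\<forall>I\<in>range J. M \<subseteq> I \<longrightarrow> I = M"
      using ex_maximal_ideal_in_family by meson
    then obtain n where "M = J n" by auto
    then have "J (Suc n) = J n" using M(2) J_mono[of n] by simp
    then show ?thesis ..
  qed
  then obtain n where n: "J (Suc n) = J n" ..
  have "c n \<oplus> \<zero> \<in> J (Suc n)"
    unfolding J(2) set_add_def'
    using additive_subgroup.zero_closed[OF ideal.axioms(1)[OF J_ideal]] cgenideal_self[OF cc]
    by blast
  then have "c n \<in> J n" by (simp add: n)
  \<comment> \<open>Negated, so that the lower terms and the leading power x^n add up to
    zero.\<close>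
  then have "\<ominus> c n \<in> J n"
    by (rule additive_subgroup.a_inv_closed[OF ideal.axioms(1)[OF J_ideal]])
  \<comment> \<open>Coefficient lists start with the highest power, so with
    \<open>length l = n\<close> an entry put in front of \<open>l\<close> becomes the coefficient of
    x^n. Leading zeros in \<open>l\<close> are harmless, because the final list starts with
    1.\<close>
  moreover have "\<exists>l. length l = n \<and> set l \<subseteq> base_ring R \<and> f y = K.eval l x \<otimes>\<^bsub>K\<^esub> f a"
    if "y \<in> J n" for y n
    using that
  proof (induction n arbitrary: y)
    case 0
    then show ?case using ac by (simp add: J f_zero)
  next
    case (Suc n)
    then obtain s z where s: "s \<in> carrier R" "z \<in> J n" "y = s \<otimes> c n \<oplus> z"
      unfolding J(2) set_add_def' cgenideal_def by blast
    have z: "z \<in> carrier R" using ideal.Icarr[OF J_ideal s(2)] .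
    obtain l where l: "length l = n" "set l \<subseteq> base_ring R" "f z = K.eval l x \<otimes>\<^bsub>K\<^esub> f a"
      using Suc.IH[OF s(2)] by blast
    have lK: "K.eval l x \<in> carrier K"
      using l(2) x by (intro K.eval_in_carrier) (auto simp: base)
    have "f y = K.eval (f s # l) x \<otimes>\<^bsub>K\<^esub> f a"
      using s z ac x lK by (simp add: f_add f_mult fc l K.l_distr K.m_assoc)
    then show ?case using l s by (intro exI[of _ "f s # l"]) (auto simp: base)
  qed
  ultimately obtain l where l: "length l = n" "set l \<subseteq> base_ring R"
    "f (\<ominus> c n) = K.eval l x \<otimes>\<^bsub>K\<^esub> f a" by blast
  have lK: "K.eval l x \<in> carrier K"
    using l(2) x by (intro K.eval_in_carrier) (auto simp: base)
  have "K.eval (\<one>\<^bsub>K\<^esub> # l) x \<otimes>\<^bsub>K\<^esub> f a = f (c n) \<oplus>\<^bsub>K\<^esub> f (\<ominus> c n)"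
    using ac x lK by (simp add: l K.l_distr fc)
  also have "\<dots> = \<zero>\<^bsub>K\<^esub>" by (simp add: f_add[symmetric] r_neg f_zero)
  finally have "K.eval (\<one>\<^bsub>K\<^esub> # l) x = \<zero>\<^bsub>K\<^esub>"
    using K.integral[of "K.eval (\<one>\<^bsub>K\<^esub> # l) x" "f a"] f_eq[of a \<zero>] f_zero ac a x lK by auto
  moreover have "\<one>\<^bsub>K\<^esub> # l \<in> carrier (univ_poly K (base_ring R))"
    using l(2) f_one by (auto simp: univ_poly_def polynomial_def base)
  ultimately have "integral_over K (base_ring R) x"
    unfolding integral_over_def by force
  then have "x \<in> base_ring R"
    using integrally_closed x unfolding integrally_closed_def K_def by blast
  then obtain r where r: "r \<in> carrier R" "x = f r" by (auto simp: base)
  then have "b = r \<otimes> a" using ac a b by (simp add: x_def f_def frac_simps)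
  then show ?thesis using r by (auto simp: cgenideal_def)
qed

text \<open>Write P as a colon ideal (a : b). Then b/a maps P into R but not into P: otherwise b
  would lie in (a), which puts 1 in P. An element \<open>q\<close> of P sent outside P gives
  \<open>u\<close>.\<close>

lemma uniformizer_relation:
  assumes P: "primeideal P R" "P \<noteq> {\<zero>}"
  obtains a b q u where "a \<in> carrier R" "a \<noteq> \<zero>" "b \<in> carrier R" "q \<in> P" "u \<in> carrier R - P"
    "b \<otimes> q = a \<otimes> u" "\<And>p. p \<in> P \<Longrightarrow> \<exists>s\<in>carrier R. b \<otimes> p = a \<otimes> s"
proof -
  interpret P: primeideal P R by fact
  obtain a where a: "a \<in> P" "a \<noteq> \<zero>" using P(2) P.zero_closed by blast
  then have ac: "a \<in> carrier R" using P.Icarr by blast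
  obtain b where b: "b \<in> carrier R" and Pb: "P = {y \<in> carrier R. y \<otimes> b \<in> PIdl a}"
    using prime_eq_colon[OF P(1) a] by blast
  have *: "\<exists>s\<in>carrier R. b \<otimes> p = a \<otimes> s" if "p \<in> P" for p
  proof -
    have "p \<in> carrier R" "p \<otimes> b \<in> PIdl a" using that Pb by blast+
    then show ?thesis using ac b by (auto simp: cgenideal_def m_comm)
  qed
  have "b \<notin> PIdl a"
  proof
    assume "b \<in> PIdl a"
    then have "\<one> \<in> P" unfolding Pb using b by simp
    then show False using P.I_notcarr P.one_imp_carrier by simp
  qed
  then have "\<not> (\<forall>p\<in>P. \<exists>p'\<in>P. b \<otimes> p = a \<otimes> p')"
    using cgenidealI_integral[OF P.ideal_axioms a b] by blast
  then obtain q where q: "q \<in> P" "\<not> (\<exists>p'\<in>P. b \<otimes> q = a \<otimes> p')" by blast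
  then obtain u where u: "u \<in> carrier R" "b \<otimes> q = a \<otimes> u" using * by blast
  then have "u \<in> carrier R - P" using q(2) by blast
  from that[OF ac a(2) b q(1) this u(2) *] show thesis .
qed

end

section \<open>Powers of an ideal and cosets\<close>

context cring
begin

lemma ideal_pow_0: "P [^]\<^bsub>ideals_set R\<^esub> (0::nat) = carrier R"
  and ideal_pow_Suc: "P [^]\<^bsub>ideals_set R\<^esub> Suc k = (P [^]\<^bsub>ideals_set R\<^esub> k) \<cdot> P"
  by (simp_all add: nat_pow_def ideals_set_def)

lemma ideal_pow_1: "ideal P R \<Longrightarrow> P [^]\<^bsub>ideals_set R\<^esub> (1::nat) = P"
  unfolding One_nat_def ideal_pow_Suc ideal_pow_0 by (simp add: ideal_prod_one ideal_prod_commute oneideal)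

lemma ideal_pow_ideal: "ideal P R \<Longrightarrow> ideal (P [^]\<^bsub>ideals_set R\<^esub> (k::nat)) R"
  by (induction k) (simp_all only: ideal_pow_0 ideal_pow_Suc oneideal ideal_prod_is_ideal)

lemma ideal_pow_Suc_subset:
  assumes "ideal P R"
  shows "P [^]\<^bsub>ideals_set R\<^esub> Suc k \<subseteq> P [^]\<^bsub>ideals_set R\<^esub> k" "P [^]\<^bsub>ideals_set R\<^esub> Suc k \<subseteq> P"
  using ideal_prod_inter[OF ideal_pow_ideal[OF assms, of k] assms] unfolding ideal_pow_Suc by blast+

lemma nat_pow_mem_ideal_pow:
  "q \<in> P \<Longrightarrow> q [^] (k::nat) \<in> P [^]\<^bsub>ideals_set R\<^esub> k"
  by (induction k) (simp_all only: ideal_pow_0 ideal_pow_Suc ideal_prod.prod nat_pow_0 nat_pow_Suc one_closed)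

text \<open>Maximality gives an inverse w of x modulo P. If v is an inverse modulo P^k, then (v x -
  1)(w x - 1) lies in P^(k+1), and its negative has again the form v' x - 1.\<close>

lemma maximalideal_inverse_mod_pow:
  assumes "maximalideal P R" "x \<in> carrier R - P"
  shows "\<exists>v\<in>carrier R. v \<otimes> x \<ominus> \<one> \<in> P [^]\<^bsub>ideals_set R\<^esub> (k::nat)"
proof -
  interpret P: maximalideal P R by fact
  have x: "x \<in> carrier R" "x \<notin> P" using assms by auto
  have Pc: "p \<in> P \<Longrightarrow> p \<in> carrier R" for p by (rule P.Icarr)
  have "ideal (PIdl x <+>\<^bsub>R\<^esub> P) R"
    by (simp add: add_ideals cgenideal_ideal x P.ideal_axioms)
  moreover have "x \<oplus> \<zero> \<in> PIdl x <+>\<^bsub>R\<^esub> P"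
    unfolding set_add_def' using cgenideal_self[OF x(1)] P.zero_closed by blast
  moreover have "P \<subseteq> PIdl x <+>\<^bsub>R\<^esub> P"
  proof
    fix p assume p: "p \<in> P"
    have "\<zero> \<in> PIdl x"
      using additive_subgroup.zero_closed[OF ideal.axioms(1)[OF cgenideal_ideal[OF x(1)]]] .
    then have "\<zero> \<oplus> p \<in> PIdl x <+>\<^bsub>R\<^esub> P" unfolding set_add_def' using p by blast
    then show "p \<in> PIdl x <+>\<^bsub>R\<^esub> P" using Pc[OF p] by simp
  qed
  ultimately have "PIdl x <+>\<^bsub>R\<^esub> P = carrier R"
    using P.I_maximal[of "PIdl x <+>\<^bsub>R\<^esub> P"] x ideal.Icarr[of "PIdl x <+>\<^bsub>R\<^esub> P" R] by auto
  then have "\<one> \<in> PIdl x <+>\<^bsub>R\<^esub> P" by simp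
  then obtain w p where w: "w \<in> carrier R" "p \<in> P" "\<one> = w \<otimes> x \<oplus> p"
    unfolding set_add_def' cgenideal_def by blast
  have "w \<otimes> x \<ominus> (w \<otimes> x \<oplus> p) = \<ominus> p" using w(1) x(1) Pc[OF w(2)] by algebra
  then have wx: "w \<otimes> x \<ominus> \<one> \<in> P" using w(2,3) by simp
  show ?thesis
  proof (induction k)
    case 0
    show ?case unfolding ideal_pow_0 using x by blast
  next
    case (Suc k)
    then obtain v where v: "v \<in> carrier R" "v \<otimes> x \<ominus> \<one> \<in> P [^]\<^bsub>ideals_set R\<^esub> k" by blast
    interpret I: ideal "P [^]\<^bsub>ideals_set R\<^esub> Suc k" R by (rule ideal_pow_ideal[OF P.ideal_axioms])
    have "\<ominus> ((v \<otimes> x \<ominus> \<one>) \<otimes> (w \<otimes> x \<ominus> \<one>)) \<in> P [^]\<^bsub>ideals_set R\<^esub> Suc k"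
      using v(2) wx unfolding ideal_pow_Suc by (intro I.a_inv_closed[unfolded ideal_pow_Suc] ideal_prod.prod)
    moreover have "\<ominus> ((v \<otimes> x \<ominus> \<one>) \<otimes> (w \<otimes> x \<ominus> \<one>)) = (v \<oplus> w \<ominus> v \<otimes> w \<otimes> x) \<otimes> x \<ominus> \<one>"
      using v(1) w(1) x(1) by algebra
    ultimately show ?case using v(1) w(1) x(1) by (metis a_closed m_closed minus_closed)
  qed
qed

text \<open>A coset is a unit iff some v x - 1 lies in P^k. For x in P this would put 1 in P, as P^k
  lies in P. For \<open>k = 0\<close> the quotient would be the zero ring, where every coset is a
  unit.\<close>

lemma coset_unit_iff:
  assumes "maximalideal P R" "(k::nat) > 0" "x \<in> carrier R"
  shows "P [^]\<^bsub>ideals_set R\<^esub> k +> x \<in> Units (R Quot (P [^]\<^bsub>ideals_set R\<^esub> k)) \<longleftrightarrow> x \<notin> P"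
proof -
  define I where "I = P [^]\<^bsub>ideals_set R\<^esub> k"
  interpret P: maximalideal P R by fact
  interpret I: ideal I R unfolding I_def by (rule ideal_pow_ideal[OF P.ideal_axioms])
  have IP: "I \<subseteq> P" unfolding I_def using assms(2) ideal_pow_Suc_subset(2)[OF P.ideal_axioms]
    by (metis Suc_pred)
  have simps: "carrier (R Quot I) = (+>) I ` carrier R" "\<one>\<^bsub>R Quot I\<^esub> = I +> \<one>"
    "\<And>x y. x \<in> carrier R \<Longrightarrow> y \<in> carrier R \<Longrightarrow> (I +> x) \<otimes>\<^bsub>R Quot I\<^esub> (I +> y) = I +> (x \<otimes> y)"
    by (auto simp: FactRing_simps I.rcoset_mult_add)
  have coset_eq: "I +> x = I +> y \<longleftrightarrow> x \<ominus> y \<in> I" if "x \<in> carrier R" "y \<in> carrier R" for x y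
    using quotient_eq_iff_same_a_r_cos[OF I.ideal_axioms that] by simp
  have "I +> x \<in> Units (R Quot I) \<longleftrightarrow> (\<exists>v\<in>carrier R. v \<otimes> x \<ominus> \<one> \<in> I)"
    using assms(3) by (auto simp: Units_def simps coset_eq m_comm)
  also have "\<dots> \<longleftrightarrow> x \<notin> P"
  proof
    assume "\<exists>v\<in>carrier R. v \<otimes> x \<ominus> \<one> \<in> I"
    then obtain v where v: "v \<in> carrier R" "v \<otimes> x \<ominus> \<one> \<in> P" using IP by blast
    show "x \<notin> P"
    proof
      assume "x \<in> P"
      then have "v \<otimes> x \<oplus> \<ominus> (v \<otimes> x \<ominus> \<one>) \<in> P"
        using v by (intro P.a_closed P.a_inv_closed P.I_l_closed)
      moreover have "v \<otimes> x \<oplus> \<ominus> (v \<otimes> x \<ominus> \<one>) = \<one>" using v(1) assms(3) by algebra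
      ultimately show False using P.I_notcarr P.one_imp_carrier by simp
    qed
  next
    assume "x \<notin> P"
    then show "\<exists>v\<in>carrier R. v \<otimes> x \<ominus> \<one> \<in> I"
      unfolding I_def using maximalideal_inverse_mod_pow[OF assms(1)] assms(3) by blast
  qed
  finally show ?thesis unfolding I_def .
qed

text \<open>The bijection sends the cosets of \<open>x\<close> modulo \<open>I\<close> and of \<open>y\<close> modulo \<open>P\<close> to the coset of
  \<open>x + y t\<close> modulo \<open>J\<close>, for fixed representatives \<open>x\<close> and \<open>y\<close>.\<close>

lemma card_cosets_principal_extension:
  assumes "ideal P R" "ideal I R" "ideal J R" "J \<subseteq> I" "I \<subseteq> P" "t \<in> I"
    and Pt: "\<And>p. p \<in> P \<Longrightarrow> p \<otimes> t \<in> J"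
    and inj: "\<And>y. y \<in> carrier R \<Longrightarrow> y \<otimes> t \<in> J \<Longrightarrow> y \<in> P"
    and surj: "\<And>z. z \<in> I \<Longrightarrow> \<exists>y\<in>carrier R. z \<ominus> y \<otimes> t \<in> J"
    and A: "A \<subseteq> carrier R" "\<And>x p. x \<in> A \<Longrightarrow> p \<in> P \<Longrightarrow> x \<oplus> p \<in> A"
  shows "card ((+>) J ` A) = card ((+>) P ` carrier R) * card ((+>) I ` A)"
proof -
  interpret P: ideal P R by fact
  interpret I: ideal I R by fact
  interpret J: ideal J R by fact
  have t: "t \<in> carrier R" using assms(6) by (rule I.Icarr)
  have eqP: "P +> x = P +> y \<longleftrightarrow> x \<ominus> y \<in> P" and eqI: "I +> x = I +> y \<longleftrightarrow> x \<ominus> y \<in> I"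
    and eqJ: "J +> x = J +> y \<longleftrightarrow> x \<ominus> y \<in> J" if "x \<in> carrier R" "y \<in> carrier R" for x y
    using quotient_eq_iff_same_a_r_cos[OF _ that] assms(1-3) by simp_all
  define f where "f = inv_into A ((+>) I)"
  define g where "g = inv_into (carrier R) ((+>) P)"
  have f: "f C \<in> A" "I +> f C = C" if "C \<in> (+>) I ` A" for C
    using that by (simp_all add: f_def inv_into_into f_inv_into_f)
  have g: "g C \<in> carrier R" "P +> g C = C" if "C \<in> (+>) P ` carrier R" for C
    using that by (simp_all add: g_def inv_into_into f_inv_into_f)
  define h where "h = (\<lambda>(B, C). J +> (f C \<oplus> g B \<otimes> t))"
  have "bij_betw h ((+>) P ` carrier R \<times> (+>) I ` A) ((+>) J ` A)"
  proof (rule bij_betw_imageI)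
    show "inj_on h ((+>) P ` carrier R \<times> (+>) I ` A)"
    proof (rule inj_onI)
      fix D D'
      assume "D \<in> (+>) P ` carrier R \<times> (+>) I ` A" "D' \<in> (+>) P ` carrier R \<times> (+>) I ` A"
      then obtain B C B' C' where D: "D = (B, C)" "D' = (B', C')"
        and mem: "B \<in> (+>) P ` carrier R" "B' \<in> (+>) P ` carrier R" "C \<in> (+>) I ` A" "C' \<in> (+>) I ` A"
        by blast
      assume eq: "h D = h D'"
      have c: "f C \<in> carrier R" "f C' \<in> carrier R" "g B \<in> carrier R" "g B' \<in> carrier R"
        using f g mem A(1) by auto
      have *: "(f C \<oplus> g B \<otimes> t) \<ominus> (f C' \<oplus> g B' \<otimes> t) \<in> J"
        using eq c t by (simp add: D h_def eqJ)
      \<comment> \<open>Modulo I the multiples of \<open>t\<close> vanish, so equal images already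
        force \<open>C = C'\<close>.\<close>
      have "((f C \<oplus> g B \<otimes> t) \<ominus> (f C' \<oplus> g B' \<otimes> t)) \<oplus> (g B' \<ominus> g B) \<otimes> t \<in> I"
        using * assms(4,6) c by (intro I.a_closed I.I_l_closed) auto
      moreover have "((f C \<oplus> g B \<otimes> t) \<ominus> (f C' \<oplus> g B' \<otimes> t)) \<oplus> (g B' \<ominus> g B) \<otimes> t = f C \<ominus> f C'"
        using c t by algebra
      ultimately have C: "C = C'" using eqI[of "f C" "f C'"] c f(2) mem by simp
      have "(f C \<oplus> g B \<otimes> t) \<ominus> (f C \<oplus> g B' \<otimes> t) = (g B \<ominus> g B') \<otimes> t"
        using c t by algebra
      with * C have "g B \<ominus> g B' \<in> P" using inj[of "g B \<ominus> g B'"] c by simp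
      then have "B = B'" using eqP[of "g B" "g B'"] c g(2) mem by simp
      with C show "D = D'" by (simp add: D)
    qed
    show "h ` ((+>) P ` carrier R \<times> (+>) I ` A) = (+>) J ` A"
    proof (intro equalityI subsetI)
      fix D assume "D \<in> h ` ((+>) P ` carrier R \<times> (+>) I ` A)"
      then obtain B C where BC: "B \<in> (+>) P ` carrier R" "C \<in> (+>) I ` A" "D = h (B, C)" by blast
      have "g B \<otimes> t \<in> P" using g(1)[OF BC(1)] assms(5,6) by (auto intro: P.I_l_closed)
      then have "f C \<oplus> g B \<otimes> t \<in> A" using A(2) f(1)[OF BC(2)] by blast
      then show "D \<in> (+>) J ` A" by (simp add: BC(3) h_def)
    next
      fix D assume "D \<in> (+>) J ` A"
      then obtain x where x: "x \<in> A" "D = J +> x" by blast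
      then have xc: "x \<in> carrier R" using A(1) by blast
      define C where "C = I +> x"
      have C: "C \<in> (+>) I ` A" using x by (simp add: C_def)
      then have fc: "f C \<in> carrier R" using f(1) A(1) by blast
      have "x \<ominus> f C \<in> I" using eqI[OF xc fc] f(2)[OF C] by (simp add: C_def)
      then obtain y where y: "y \<in> carrier R" "x \<ominus> f C \<ominus> y \<otimes> t \<in> J" using surj by blast
      define B where "B = P +> y"
      have B: "B \<in> (+>) P ` carrier R" using y by (simp add: B_def)
      have gc: "g B \<in> carrier R" using g(1)[OF B] .
      have "y \<ominus> g B \<in> P" using eqP[OF y(1) gc] g(2)[OF B] by (simp add: B_def)
      \<comment> \<open>Replacing \<open>y\<close> by the chosen representative \<open>g B\<close>
        costs (y - g B) t, which \<open>Pt\<close> places in J.\<close>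
      then have "(x \<ominus> f C \<ominus> y \<otimes> t) \<oplus> (y \<ominus> g B) \<otimes> t \<in> J"
        using y(2) Pt by (intro J.a_closed)
      moreover have "(x \<ominus> f C \<ominus> y \<otimes> t) \<oplus> (y \<ominus> g B) \<otimes> t = x \<ominus> (f C \<oplus> g B \<otimes> t)"
        using xc fc gc y(1) t by algebra
      ultimately have "D = h (B, C)" using eqJ[OF xc, of "f C \<oplus> g B \<otimes> t"] fc gc t
        by (simp add: x(2) h_def)
      then show "D \<in> h ` ((+>) P ` carrier R \<times> (+>) I ` A)" using B C by blast
    qed
  qed
  then show ?thesis using bij_betw_same_card[of h] card_cartesian_product by metis
qed

section \<open>Multipliers taking powers of P into principal ideals\<close>

text \<open>Each factor from P absorbs one \<open>u\<close> and releases one \<open>q\<close>; sums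
  of products are covered by induction over the product ideal. The lemma serves the pair u, q of the
  uniformizer relation and also the pair b, a.\<close>

lemma mult_pow_mem_ideal_pow:
  assumes "ideal P R" "u \<in> carrier R" "q \<in> carrier R"
    and "\<And>p. p \<in> P \<Longrightarrow> \<exists>s\<in>carrier R. u \<otimes> p = q \<otimes> s"
    and "z \<in> P [^]\<^bsub>ideals_set R\<^esub> (k::nat)"
  shows "\<exists>s\<in>carrier R. u [^] k \<otimes> z = q [^] k \<otimes> s"
  using assms(5)
proof (induction k arbitrary: z)
  case 0
  then show ?case by (auto simp only: ideal_pow_0 nat_pow_0)
next
  case (Suc k)
  note uq = nat_pow_closed[OF assms(2), of k] nat_pow_closed[OF assms(3), of k]
  have Pk: "x \<in> carrier R" if "x \<in> P [^]\<^bsub>ideals_set R\<^esub> k" for x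
    using ideal.Icarr[OF ideal_pow_ideal[OF assms(1)] that] .
  from Suc.prems show ?case unfolding ideal_pow_Suc
  proof (induction z rule: ideal_prod.induct)
    case (prod i j)
    obtain s where s: "s \<in> carrier R" "u [^] k \<otimes> i = q [^] k \<otimes> s" using Suc.IH[OF prod(1)] by blast
    obtain s' where s': "s' \<in> carrier R" "u \<otimes> j = q \<otimes> s'" using assms(4)[OF prod(2)] by blast
    have c: "i \<in> carrier R" "j \<in> carrier R" using Pk[OF prod(1)] ideal.Icarr[OF assms(1) prod(2)] .
    have "u [^] Suc k \<otimes> (i \<otimes> j) = (u [^] k \<otimes> i) \<otimes> (u \<otimes> j)"
      using c uq assms(2) by (simp add: m_ac)
    also have "\<dots> = q [^] Suc k \<otimes> (s \<otimes> s')"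
      unfolding s(2) s'(2) using s(1) s'(1) uq assms(3) by (simp add: m_ac)
    finally show ?case using s(1) s'(1) by (intro bexI[of _ "s \<otimes> s'"]) simp_all
  next
    case (sum x y)
    then obtain s s' where s: "s \<in> carrier R" "u [^] Suc k \<otimes> x = q [^] Suc k \<otimes> s"
      "s' \<in> carrier R" "u [^] Suc k \<otimes> y = q [^] Suc k \<otimes> s'" by blast
    have c: "x \<in> carrier R" "y \<in> carrier R"
      using sum(1,2) ideal_prod_in_carrier[OF ideal_pow_ideal[OF assms(1)] assms(1)] by blast+
    have "u [^] Suc k \<otimes> (x \<oplus> y) = q [^] Suc k \<otimes> (s \<oplus> s')"
      using s c nat_pow_closed[OF assms(2), of "Suc k"] nat_pow_closed[OF assms(3), of "Suc k"]
      by (simp only: r_distr)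
    then show ?case using s by blast
  qed
qed

text \<open>Only k of the k + 1 factors from P are spent against \<open>b\<close>; the last one
  survives and keeps the cofactor in P. This later shows that y q^k can lie in P^(k+1) only for y in
  P.\<close>

lemma mult_pow_mem_ideal_pow_Suc:
  assumes "ideal P R" "b \<in> carrier R" "a \<in> carrier R"
    and "\<And>p. p \<in> P \<Longrightarrow> \<exists>s\<in>carrier R. b \<otimes> p = a \<otimes> s"
    and "z \<in> P [^]\<^bsub>ideals_set R\<^esub> Suc k"
  shows "\<exists>s\<in>P. b [^] k \<otimes> z = a [^] k \<otimes> s"
proof -
  interpret P: ideal P R by fact
  note ba = nat_pow_closed[OF assms(2), of k] nat_pow_closed[OF assms(3), of k]
  from assms(5) show ?thesis unfolding ideal_pow_Suc
  proof (induction z rule: ideal_prod.induct)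
    case (prod i j)
    obtain s where s: "s \<in> carrier R" "b [^] k \<otimes> i = a [^] k \<otimes> s"
      using mult_pow_mem_ideal_pow[OF assms(1-4) prod(1)] by blast
    have c: "i \<in> carrier R" "j \<in> carrier R"
      using ideal.Icarr[OF ideal_pow_ideal[OF assms(1)] prod(1)] P.Icarr[OF prod(2)] .
    have "b [^] k \<otimes> (i \<otimes> j) = (a [^] k \<otimes> s) \<otimes> j"
      unfolding s(2)[symmetric] using c ba by (simp add: m_assoc)
    then show ?case using s(1) c ba P.I_l_closed[OF prod(2) s(1)]
      by (intro bexI[of _ "s \<otimes> j"]) (simp_all add: m_assoc)
  next
    case (sum x y)
    then obtain s s' where s: "s \<in> P" "b [^] k \<otimes> x = a [^] k \<otimes> s"
      "s' \<in> P" "b [^] k \<otimes> y = a [^] k \<otimes> s'" by blast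
    have c: "x \<in> carrier R" "y \<in> carrier R"
      using sum(1,2) ideal_prod_in_carrier[OF ideal_pow_ideal[OF assms(1)] assms(1)] by blast+
    have "b [^] k \<otimes> (x \<oplus> y) = a [^] k \<otimes> (s \<oplus> s')"
      using s c ba P.Icarr by (simp only: r_distr)
    then show ?case using s P.a_closed by blast
  qed
qed

end

context dedekind_domain
begin

text \<open>With \<open>b q = a u\<close> as in \<open>uniformizer_relation\<close>, the powers of \<open>q\<close> generate the
  one-dimensional quotients \<open>P\<^sup>k / P\<^sup>k\<^sup>+\<^sup>1\<close>.\<close>

lemma ideal_pow_quotient_generator:
  assumes P: "primeideal P R" "P \<noteq> {\<zero>}"
  obtains q where "q \<in> P"
    "\<And>k y. y \<in> carrier R \<Longrightarrow> y \<otimes> q [^] (k::nat) \<in> P [^]\<^bsub>ideals_set R\<^esub> Suc k \<Longrightarrow> y \<in> P"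
    "\<And>k z. z \<in> P [^]\<^bsub>ideals_set R\<^esub> (k::nat) \<Longrightarrow>
      \<exists>y\<in>carrier R. z \<ominus> y \<otimes> q [^] k \<in> P [^]\<^bsub>ideals_set R\<^esub> Suc k"
proof -
  interpret P: primeideal P R by fact
  have max: "maximalideal P R" using primeideal_maximal P .
  obtain a b q u where abqu: "a \<in> carrier R" "a \<noteq> \<zero>" "b \<in> carrier R" "q \<in> P" "u \<in> carrier R - P"
    "b \<otimes> q = a \<otimes> u" and ab: "\<And>p. p \<in> P \<Longrightarrow> \<exists>s\<in>carrier R. b \<otimes> p = a \<otimes> s"
    using uniformizer_relation[OF P] by blast
  have u: "u \<in> carrier R" "u \<notin> P" and q: "q \<in> carrier R" using abqu P.Icarr by auto
  have u_pow: "u [^] k \<notin> P" for k :: nat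
  proof (induction k)
    case 0
    show ?case using P.one_imp_carrier P.I_notcarr by auto
  next
    case (Suc k)
    then show ?case using P.I_prime[of "u [^] k" u] u by auto
  qed
  \<comment> \<open>Multiplied by \<open>a\<close>, the claim follows from b q = a u: a u p = q (b
    p) = a q s. Then \<open>a\<close> is cancelled.\<close>
  have uq: "\<exists>s\<in>carrier R. u \<otimes> p = q \<otimes> s" if "p \<in> P" for p
  proof -
    obtain s where s: "s \<in> carrier R" "b \<otimes> p = a \<otimes> s" using ab[OF \<open>p \<in> P\<close>] by blast
    have p: "p \<in> carrier R" using P.Icarr[OF \<open>p \<in> P\<close>] .
    have "a \<otimes> (u \<otimes> p) = (b \<otimes> q) \<otimes> p" using abqu p u by (simp add: m_assoc)
    also have "\<dots> = q \<otimes> (b \<otimes> p)" using abqu(3) p q by (simp add: m_ac)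
    also have "\<dots> = a \<otimes> (q \<otimes> s)" unfolding s(2) using abqu(1) s(1) q by (simp add: m_ac)
    finally have "u \<otimes> p = q \<otimes> s" using abqu(1,2) u(1) q p s(1) m_lcancel by simp
    with s(1) show ?thesis by blast
  qed
  show thesis
  proof (rule that[OF abqu(4)])
    fix k y assume y: "y \<in> carrier R" "y \<otimes> q [^] (k::nat) \<in> P [^]\<^bsub>ideals_set R\<^esub> Suc k"
    obtain s where s: "s \<in> P" "b [^] k \<otimes> (y \<otimes> q [^] k) = a [^] k \<otimes> s"
      using mult_pow_mem_ideal_pow_Suc[OF P.ideal_axioms abqu(3,1) ab y(2)] by blast
    \<comment> \<open>Since b^k q^k = a^k u^k, cancelling a^k leaves y u^k in P, where u^k is
      outside P.\<close>
    have "a [^] k \<otimes> (y \<otimes> u [^] k) = y \<otimes> (a \<otimes> u) [^] k"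
      using abqu(1) u(1) y(1) by (simp add: nat_pow_distrib m_lcomm)
    also have "\<dots> = b [^] k \<otimes> (y \<otimes> q [^] k)"
      unfolding abqu(6)[symmetric] using abqu(3) q y(1) by (simp add: nat_pow_distrib m_lcomm)
    finally have "a [^] k \<otimes> (y \<otimes> u [^] k) = a [^] k \<otimes> s" using s(2) by simp
    moreover have "a [^] k \<noteq> \<zero>"
      using abqu(1,2) by (induction k) (auto simp: integral_iff)
    ultimately have "y \<otimes> u [^] k = s"
      using m_lcancel[of "a [^] k"] abqu(1) y(1) u(1) P.Icarr[OF s(1)] by simp
    then show "y \<in> P" using P.I_prime[of y "u [^] k"] y(1) u(1) u_pow s(1) by auto
  next
    fix k z assume z: "z \<in> P [^]\<^bsub>ideals_set R\<^esub> (k::nat)"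
    have zc: "z \<in> carrier R" using ideal.Icarr[OF ideal_pow_ideal[OF P.ideal_axioms] z] .
    obtain s where s: "s \<in> carrier R" "u [^] k \<otimes> z = q [^] k \<otimes> s"
      using mult_pow_mem_ideal_pow[OF P.ideal_axioms u(1) q uq z] by blast
    obtain v where v: "v \<in> carrier R" "v \<otimes> u [^] k \<ominus> \<one> \<in> P"
      using maximalideal_inverse_mod_pow[OF max, of "u [^] k" 1] u u_pow
      unfolding ideal_pow_1[OF P.ideal_axioms] by auto
    \<comment> \<open>\<open>v\<close> inverts u^k modulo P, so z (1 - v u^k) lies in P^k P. As v
      u^k z = v s q^k, the witness is v s.\<close>
    have "z \<otimes> \<ominus> (v \<otimes> u [^] k \<ominus> \<one>) \<in> P [^]\<^bsub>ideals_set R\<^esub> Suc k"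
      unfolding ideal_pow_Suc by (rule ideal_prod.prod[OF z P.a_inv_closed[OF v(2)]])
    moreover have "z \<otimes> \<ominus> (v \<otimes> u [^] k \<ominus> \<one>) = z \<ominus> v \<otimes> (u [^] k \<otimes> z)"
      using v(1) zc nat_pow_closed[OF u(1), of k] by algebra
    moreover have "v \<otimes> (u [^] k \<otimes> z) = (v \<otimes> s) \<otimes> q [^] k"
      unfolding s(2) using v(1) s(1) q by (simp add: m_ac)
    ultimately show "\<exists>y\<in>carrier R. z \<ominus> y \<otimes> q [^] k \<in> P [^]\<^bsub>ideals_set R\<^esub> Suc k"
      using v(1) s(1) by (metis m_closed)
  qed
qed

text \<open>\<open>A\<close> is a union of cosets of P, and each coset of P^(k+1) inside it splits
  into |R/P| cosets of P^(k+2). Indexing by \<open>Suc k\<close> starts the induction at P itself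
  and makes the exponent k.\<close>

lemma card_cosets_ideal_pow:
  assumes P: "primeideal P R" "P \<noteq> {\<zero>}"
    and A: "A \<subseteq> carrier R" "\<And>x p. x \<in> A \<Longrightarrow> p \<in> P \<Longrightarrow> x \<oplus> p \<in> A"
  shows "card ((+>) (P [^]\<^bsub>ideals_set R\<^esub> Suc k) ` A)
    = card ((+>) P ` carrier R) ^ k * card ((+>) P ` A)"
proof (induction k)
  case 0
  interpret P: primeideal P R by fact
  show ?case using ideal_pow_1[OF P.ideal_axioms] by simp
next
  case (Suc k)
  interpret P: primeideal P R by fact
  obtain q where q: "q \<in> P"
    "\<And>k y. y \<in> carrier R \<Longrightarrow> y \<otimes> q [^] (k::nat) \<in> P [^]\<^bsub>ideals_set R\<^esub> Suc k \<Longrightarrow> y \<in> P"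
    "\<And>k z. z \<in> P [^]\<^bsub>ideals_set R\<^esub> (k::nat) \<Longrightarrow>
      \<exists>y\<in>carrier R. z \<ominus> y \<otimes> q [^] k \<in> P [^]\<^bsub>ideals_set R\<^esub> Suc k"
    using ideal_pow_quotient_generator[OF P] by blast
  have q_pow: "q [^] Suc k \<in> P [^]\<^bsub>ideals_set R\<^esub> Suc k" by (rule nat_pow_mem_ideal_pow[OF q(1)])
  have "p \<otimes> q [^] Suc k \<in> P [^]\<^bsub>ideals_set R\<^esub> Suc (Suc k)" if "p \<in> P" for p
    unfolding ideal_pow_Suc[of P "Suc k"]
    using ideal_prod.prod[OF q_pow that, of R] m_comm[OF P.Icarr[OF that] nat_pow_closed[OF P.Icarr[OF q(1)], of "Suc k"]]
    by simp
  \<comment> \<open>Taken with I = P^(k+1), J = P^(k+2) and t = q^(k+1).\<close>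
  from card_cosets_principal_extension[OF P.ideal_axioms ideal_pow_ideal[OF P.ideal_axioms]
      ideal_pow_ideal[OF P.ideal_axioms] ideal_pow_Suc_subset(1)[OF P.ideal_axioms]
      ideal_pow_Suc_subset(2)[OF P.ideal_axioms] q_pow this _ q(3) A]
  have "card ((+>) (P [^]\<^bsub>ideals_set R\<^esub> Suc (Suc k)) ` A)
    = card ((+>) P ` carrier R) * card ((+>) (P [^]\<^bsub>ideals_set R\<^esub> Suc k) ` A)"
    using q(2)[of _ "Suc k"] by blast
  then show ?case unfolding Suc.IH by simp
qed

end

section \<open>Counting the cosets avoiding \<open>P\<close>\<close>

lemma ring_char_pos_least:
  fixes n :: nat
  assumes "n > 0" "add_pow R n \<one>\<^bsub>R\<^esub> = \<zero>\<^bsub>R\<^esub>"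
  shows "ring_char R > 0" "add_pow R (ring_char R) \<one>\<^bsub>R\<^esub> = \<zero>\<^bsub>R\<^esub>" "ring_char R \<le> n"
proof -
  let ?Q = "\<lambda>n::nat. 0 < n \<and> add_pow R n \<one>\<^bsub>R\<^esub> = \<zero>\<^bsub>R\<^esub>"
  have "ring_char R = (LEAST n. ?Q n)" unfolding ring_char_def using assms by (subst if_P) blast+
  then show "ring_char R > 0" "add_pow R (ring_char R) \<one>\<^bsub>R\<^esub> = \<zero>\<^bsub>R\<^esub>" "ring_char R \<le> n"
    using LeastI[of ?Q n] Least_le[of ?Q n] assms by auto
qed

lemma (in ideal) add_pow_quotient:
  "add_pow (R Quot I) (n::nat) \<one>\<^bsub>R Quot I\<^esub> = I +> add_pow R n \<one>"
proof (induction n)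
  interpret Q: ring "R Quot I" by (rule quotient_is_ring)
  case 0
  have "add_pow (R Quot I) (0::nat) \<one>\<^bsub>R Quot I\<^esub> = \<zero>\<^bsub>R Quot I\<^esub>" by simp
  then show ?case by (simp add: FactRing_def a_subset)
next
  interpret Q: ring "R Quot I" by (rule quotient_is_ring)
  case (Suc n)
  then show ?case by (simp add: Q.add.nat_pow_Suc) (simp add: FactRing_def a_rcos_sum)
qed

text \<open>x + i lies in P exactly when x and -i have the same coset, so the cosets of 0, -1, ...,
  -(r-1) drop out, and periodicity leaves \<open>min r c\<close> distinct ones. The additive form
  avoids truncated subtraction.\<close>

lemma (in cring) card_cosets_avoiding:
  assumes "ideal P R" "finite ((+>) P ` carrier R)"
  shows "card ((+>) P ` {x \<in> carrier R. \<forall>i\<in>{0..<r}. x \<oplus> add_pow R i \<one> \<notin> P})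
    + min r (ring_char (R Quot P)) = card ((+>) P ` carrier R)" (is "card (_ ` ?A) + _ = _")
proof -
  interpret P: ideal P R by fact
  define e where "e n = add_pow R n \<one>" for n :: nat
  define c where "c = ring_char (R Quot P)"
  have ec[simp]: "e n \<in> carrier R" for n by (simp add: e_def)
  have e_add: "e (m + n) = e m \<oplus> e n" for m n by (simp add: e_def add.nat_pow_mult)
  have eqP: "P +> x = P +> y \<longleftrightarrow> x \<ominus> y \<in> P" if "x \<in> carrier R" "y \<in> carrier R" for x y
    using quotient_eq_iff_same_a_r_cos[OF P.ideal_axioms that] by simp
  have e_zero: "add_pow (R Quot P) n \<one>\<^bsub>R Quot P\<^esub> = \<zero>\<^bsub>R Quot P\<^esub> \<longleftrightarrow> e n \<in> P" for n
    unfolding P.add_pow_quotient e_def[symmetric] using eqP[of "e n" \<zero>] P.a_subset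
    by (simp add: FactRing_def a_minus_def)
  have e_diff: "e (j - i) \<in> P" if "i < j" "P +> \<ominus> e i = P +> \<ominus> e j" for i j
  proof -
    have "e j = e i \<oplus> e (j - i)" using e_add[of i "j - i"] that(1) by simp
    moreover have "\<ominus> e i \<ominus> (\<ominus> (e i \<oplus> e (j - i))) = e (j - i)"
      using ec[of i] ec[of "j - i"] by algebra
    ultimately have "\<ominus> e i \<ominus> (\<ominus> e j) = e (j - i)" by simp
    then show ?thesis using eqP[of "\<ominus> e i" "\<ominus> e j"] that(2) by simp
  qed
  \<comment> \<open>Finitely many cosets force a collision, hence a positive multiple of 1 in P;
    this rules out the default value 0 of \<open>ring_char\<close>.\<close>
  have "\<not> inj (\<lambda>i. P +> \<ominus> e i)"
  proof
    assume "inj (\<lambda>i. P +> \<ominus> e i)"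
    moreover have "finite (range (\<lambda>i. P +> \<ominus> e i))"
      by (rule finite_subset[OF _ assms(2)]) auto
    ultimately show False using finite_imageD infinite_UNIV_nat by blast
  qed
  then obtain i j where "i \<noteq> j" "P +> \<ominus> e i = P +> \<ominus> e j"
    unfolding inj_def by blast
  then obtain i j where ij: "i < j" "P +> \<ominus> e i = P +> \<ominus> e j"
    by (cases i j rule: linorder_cases) auto
  have c_least: "c > 0" "e c \<in> P" "c \<le> n" if "n > 0" "e n \<in> P" for n
    using ring_char_pos_least[of n "R Quot P"] that unfolding e_zero c_def by simp_all
  have c: "c > 0" "e c \<in> P" using c_least[OF _ e_diff[OF ij]] ij(1) by simp_all
  have inj: "inj_on (\<lambda>i. P +> \<ominus> e i) {..<c}"
  proof (rule linorder_inj_onI')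
    fix i j assume "i \<in> {..<c}" "j \<in> {..<c}" "i < j"
    then show "P +> \<ominus> e i \<noteq> P +> \<ominus> e j" using e_diff[of i j] c_least(3)[of "j - i"] by auto
  qed
  have e_mult: "e (c * n) \<in> P" for n
    by (induction n) (simp_all add: e_add c(2), simp add: e_def)
  have e_mod: "P +> \<ominus> e n = P +> \<ominus> e (n mod c)" for n
  proof -
    have "e n = e (c * (n div c)) \<oplus> e (n mod c)" by (simp add: e_add[symmetric])
    moreover have "\<ominus> (e (c * (n div c)) \<oplus> e (n mod c)) \<ominus> (\<ominus> e (n mod c)) = \<ominus> e (c * (n div c))"
      using ec[of "c * (n div c)"] ec[of "n mod c"] by algebra
    ultimately have "\<ominus> e n \<ominus> (\<ominus> e (n mod c)) = \<ominus> e (c * (n div c))" by simp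
    then show ?thesis using eqP[of "\<ominus> e n" "\<ominus> e (n mod c)"] e_mult by simp
  qed
  have image_eq: "(\<lambda>i. P +> \<ominus> e i) ` {..<r} = (\<lambda>i. P +> \<ominus> e i) ` {..<min r c}"
  proof
    show "(\<lambda>i. P +> \<ominus> e i) ` {..<r} \<subseteq> (\<lambda>i. P +> \<ominus> e i) ` {..<min r c}"
    proof clarify
      fix i assume "i < r"
      then have "i mod c < min r c" using c(1) by (simp add: le_less_trans[OF mod_less_eq_dividend])
      then show "P +> \<ominus> e i \<in> (\<lambda>i. P +> \<ominus> e i) ` {..<min r c}"
        using e_mod[of i] by blast
    qed
  qed auto
  have mem: "x \<oplus> e i \<in> P \<longleftrightarrow> P +> x = P +> \<ominus> e i" if "x \<in> carrier R" for x i
    using eqP[of x "\<ominus> e i"] that by (simp add: a_minus_def)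
  have "(+>) P ` ?A = (+>) P ` carrier R - (\<lambda>i. P +> \<ominus> e i) ` {..<r}"
    unfolding e_def[symmetric] using mem by auto
  also have "\<dots> = (+>) P ` carrier R - (\<lambda>i. P +> \<ominus> e i) ` {..<min r c}" by (simp only: image_eq)
  finally have A: "(+>) P ` ?A = (+>) P ` carrier R - (\<lambda>i. P +> \<ominus> e i) ` {..<min r c}" .
  have sub: "(\<lambda>i. P +> \<ominus> e i) ` {..<min r c} \<subseteq> (+>) P ` carrier R" by auto
  have "card ((\<lambda>i. P +> \<ominus> e i) ` {..<min r c}) = min r c"
    using card_image[OF inj_on_subset[OF inj, of "{..<min r c}"]] by simp
  then show ?thesis
    using card_mono[OF assms(2) sub] unfolding A c_def[symmetric] by (simp add: card_Diff_subset sub)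
qed

theorem theorem2p2:
  fixes R :: "('a, 'b) ring_scheme" (structure) and P :: "'a set" and r \<alpha> :: nat
  assumes "dedekind_domain R"
    and "primeideal P R" and "P \<noteq> {\<zero>}"
    and "finite (carrier (R Quot P))"
    and "r > 0" and "\<alpha> > 0"
  shows "int (S_fun R (P [^]\<^bsub>ideals_set R\<^esub> \<alpha>) r) =
    (if r \<le> ring_char (R Quot P)
     then int (card (carrier (R Quot P))) ^ (\<alpha> - 1) *
       (int (card (carrier (R Quot P))) - int r)
     else int (card (carrier (R Quot P))) ^ (\<alpha> - 1) *
       (int (card (carrier (R Quot P))) - int (ring_char (R Quot P))))"
proof -
  interpret dedekind_domain R by fact
  interpret P: primeideal P R by fact
  have max: "maximalideal P R" using primeideal_maximal assms(2,3) .
  define A where "A = {x \<in> carrier R. \<forall>i\<in>{0..<r}. x \<oplus> add_pow R i \<one> \<notin> P}"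
  have quot: "carrier (R Quot P) = (+>) P ` carrier R" by (auto simp: FactRing_simps)
  \<comment> \<open>By \<open>coset_unit_iff\<close>, applied to every x + i, the condition on x no
    longer depends on \<alpha>.\<close>
  have "L_set R (P [^]\<^bsub>ideals_set R\<^esub> \<alpha>) r = (+>) (P [^]\<^bsub>ideals_set R\<^esub> \<alpha>) ` A"
    unfolding L_set_def A_def using coset_unit_iff[OF max assms(6)] by auto
  moreover have "x \<oplus> p \<in> A" if "x \<in> A" "p \<in> P" for x p
  proof -
    have c: "x \<in> carrier R" "p \<in> carrier R" using that P.Icarr by (auto simp: A_def)
    have "x \<oplus> p \<oplus> add_pow R i \<one> \<notin> P" if i: "i \<in> {0..<r}" for i :: nat
    proof
      assume "x \<oplus> p \<oplus> add_pow R i \<one> \<in> P"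
      then have "x \<oplus> p \<oplus> add_pow R i \<one> \<oplus> \<ominus> p \<in> P" using \<open>p \<in> P\<close> by blast
      moreover have "x \<oplus> p \<oplus> add_pow R i \<one> \<oplus> \<ominus> p = x \<oplus> add_pow R i \<one>"
        using c add.nat_pow_closed[OF one_closed, of i] by algebra
      ultimately show False using \<open>x \<in> A\<close> i by (simp add: A_def)
    qed
    then show ?thesis using c by (simp add: A_def)
  qed
  ultimately have "S_fun R (P [^]\<^bsub>ideals_set R\<^esub> \<alpha>) r
      = card (carrier (R Quot P)) ^ (\<alpha> - 1) * card ((+>) P ` A)"
    using card_cosets_ideal_pow[OF assms(2,3), of A "\<alpha> - 1"] assms(6)
    by (simp add: S_fun_def quot A_def)
  moreover have "card ((+>) P ` A) + min r (ring_char (R Quot P)) = card (carrier (R Quot P))"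
    unfolding A_def quot using card_cosets_avoiding[OF P.ideal_axioms] assms(4) quot by simp
  \<comment> \<open>Over the integers the subtraction is exact, and the two values of
    \<open>min\<close> are the two cases of the formula.\<close>
  then have "int (card ((+>) P ` A)) = int (card (carrier (R Quot P))) - int (min r (ring_char (R Quot P)))"
    by linarith
  ultimately show ?thesis by simp
qed

end
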